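(* Let $\mathbb{Z}$ and $\mathbb{Y}$ be finite-dimensional real inner product spaces of dimensions $m$ and $n$, respectively. Let $M:\mathbb{Z}\to\mathbb{Y}$ be a linear mapping of full column rank (i.e. injective, so that $M^*M$ is invertible), and let $\mathcal{K}\subset\mathbb{Z}$ be a closed convex cone. Then $$(M\mathcal{K})^*=M(M^*M)^{-1}\mathcal{K}^*+\operatorname{Ker}(M^* ).$$ In the case $n=m$, this reduces to $(M\mathcal{K})^*=(M^* )^{-1}\mathcal{K}^*$.
   Context: $M\mathcal{K}=\{Mx:x\in\mathcal{K}\}$. $M^*:\mathbb{Y}\to\mathbb{Z}$ is the adjoint of $M$, defined by $\langle Mx,y\rangle=\langle x,M^*y\rangle$, and $\operatorname{Ker}(M^* )$ is its kernel. For a cone $\mathcal{C}$ in an inner product space $\mathbb{E}$, the dual cone is $\mathcal{C}^*=\{y\in\mathbb{E}:\langle y,x\rangle\ge 0\ \forall x\in\mathcal{C}\}$. The sum of sets is the Minkowski sum. *)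

theory Defs
  imports "HOL-Analysis.Analysis"
begin

definition dual_cone :: "'a::real_inner set \<Rightarrow> 'a set" where
  "dual_cone C = {y. \<forall>x\<in>C. y \<bullet> x \<ge> 0}"

definition Ker :: "('a::real_vector \<Rightarrow> 'b::real_vector) \<Rightarrow> 'a set" where
  "Ker f = {x. f x = 0}"

text \<open>
  The class \<open>euclidean_space\<close> excludes the zero space. The predicate below, on a type of class
  \<open>real_inner\<close>, covers all finite-dimensional inner product spaces; finiteness of the spanning
  set has to be required separately because \<^const>\<open>dim\<close> is \<open>0\<close> on infinite-dimensional spaces.
\<close>

definition has_dimension :: "'a::real_vector itself \<Rightarrow> nat \<Rightarrow> bool" where
  "has_dimension _ n \<longleftrightarrow> (\<exists>B :: 'a set. finite B \<and> span B = UNIV) \<and> dim (UNIV :: 'a set) = n"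

end

theory Submission
  imports Defs
begin

text \<open>
  The defining property of the adjoint gives \<open>dual_cone (M ` K) = adjoint M -` dual_cone K\<close>.
  With \<open>A = adjoint M \<circ> M\<close>, the map \<open>M \<circ> inv A\<close> is a right inverse of \<open>adjoint M\<close>, so the
  preimage of \<open>dual_cone K\<close> is its image under this right inverse translated by the kernel.
  The library states existence of adjoints only for \<open>euclidean_space\<close>; here it comes from
  a Riesz representation on the span of a finite set.
\<close>

text \<open>Gram-Schmidt, one vector at a time: a representer on \<open>span B\<close> is corrected
  along the component of the new vector orthogonal to \<open>span B\<close>. The functional varies
  in the induction, because the hypothesis serves twice.\<close>

lemma riesz_span:
  fixes B :: "'a::real_inner set"
  assumes "finite B" and "linear (f :: 'a \<Rightarrow> real)"
  shows "\<exists>w\<in>span B. \<forall>x\<in>span B. f x = x \<bullet> w"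
  using assms
proof (induction B arbitrary: f rule: finite_induct)
  case empty
  then show ?case by (auto simp: linear_0)
next
  case (insert b B)
  obtain w where w: "w \<in> span B" "\<And>x. x \<in> span B \<Longrightarrow> f x = x \<bullet> w"
    using insert.IH[OF insert.prems] by blast
  \<comment> \<open>Representing this functional on \<open>span B\<close> yields \<open>p\<close>,
    the orthogonal projection of \<open>b\<close> onto \<open>span B\<close>.\<close>
  have "linear (\<lambda>x. x \<bullet> b)"
    by (simp add: bounded_linear.linear bounded_linear_inner_left)
  then obtain p where p: "p \<in> span B" "\<And>x. x \<in> span B \<Longrightarrow> x \<bullet> b = x \<bullet> p"
    using insert.IH by blast
  define c where "c = b - p"
  have orth: "x \<bullet> c = 0" if "x \<in> span B" for x
    using p(2)[OF that] by (simp add: c_def inner_diff_right)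
  \<comment> \<open>The added multiple of \<open>c\<close> does not affect products with
    \<open>span B\<close>, and it makes the product with \<open>c\<close> equal to
    \<open>f c\<close>. If \<open>b\<close> already lies in \<open>span B\<close>, then
    \<open>c = 0\<close>, the quotient is 0 by convention, and \<open>w' = w\<close>.\<close>
  define w' where "w' = w + (f c / (c \<bullet> c)) *\<^sub>R c"
  have sub: "span B \<subseteq> span (insert b B)"
    by (rule span_mono) auto
  have "c \<in> span (insert b B)"
    unfolding c_def
  proof (rule span_diff)
    show "b \<in> span (insert b B)" by (simp add: span_base)
    show "p \<in> span (insert b B)" using p(1) sub by (rule rev_subsetD)
  qed
  then have "w' \<in> span (insert b B)"
    unfolding w'_def using w(1) sub by (auto intro!: span_add span_scale)
  moreover have "f x = x \<bullet> w'" if x: "x \<in> span (insert b B)" for x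
  proof -
    obtain k where "x - k *\<^sub>R b \<in> span B"
      using x by (auto simp: span_insert)
    then have "(x - k *\<^sub>R b) + k *\<^sub>R p \<in> span B"
      using p(1) by (intro span_add span_scale)
    then have y: "x - k *\<^sub>R c \<in> span B" (is "?y \<in> _")
      by (simp add: c_def algebra_simps)
    have "?y \<bullet> w' = f ?y"
      using w(2)[OF y] orth[OF y] by (simp add: w'_def inner_add_right)
    moreover have "c \<bullet> w' = f c"
      using orth[OF w(1)] insert.prems
      by (cases "c = 0") (auto simp: w'_def inner_add_right inner_commute linear_0)
    ultimately show ?thesis
      using insert.prems by (simp add: linear_diff linear_scale inner_diff_left)
  qed
  ultimately show ?case by blast
qed

text \<open>\<open>adjoint\<close> is a choice operator, so its defining property follows once some
  adjoint exists: Riesz supplies a vector for each \<open>y\<close>, and choice collects these into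
  a function.\<close>

lemma adjoint_inner:
  fixes f :: "'a::real_inner \<Rightarrow> 'b::real_inner"
  assumes "finite B" and "span B = (UNIV :: 'a set)" and "linear f"
  shows "f x \<bullet> y = x \<bullet> adjoint f y"
proof -
  have "\<exists>w. \<forall>x. f x \<bullet> y = x \<bullet> w" for y
  proof -
    have "linear (\<lambda>x. f x \<bullet> y)"
      using linear_compose[OF assms(3), of "\<lambda>x. x \<bullet> y"]
      by (simp add: o_def bounded_linear.linear bounded_linear_inner_left)
    then show ?thesis
      using riesz_span[OF assms(1)] assms(2) by auto
  qed
  then have "\<exists>g. \<forall>x y. f x \<bullet> y = x \<bullet> g y"
    by metis
  then show ?thesis
    unfolding adjoint_def by (rule someI2_ex) blast
qed

text \<open>An injective linear map sends a basis to \<open>n\<close> independent vectors. A vector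
  outside their span would give \<open>n + 1\<close> independent vectors in a space spanned by
  \<open>n\<close>.\<close>

lemma linear_inj_imp_surj_same_dimension:
  fixes f :: "'a::real_vector \<Rightarrow> 'b::real_vector"
  assumes a: "has_dimension TYPE('a) n" and b: "has_dimension TYPE('b) n"
    and "linear f" and "inj f"
  shows "surj f"
proof -
  obtain S :: "'a set" where S: "independent S" "span S = UNIV" "card S = n"
  proof -
    obtain S :: "'a set" where "independent S" "UNIV \<subseteq> span S" "card S = dim (UNIV :: 'a set)"
      by (rule basis_exists)
    with a that[of S] show thesis
      by (simp add: has_dimension_def top_le)
  qed
  obtain T :: "'b set" where T: "independent T" "span T = UNIV" "card T = n"
  proof -
    obtain T :: "'b set" where "independent T" "UNIV \<subseteq> span T" "card T = dim (UNIV :: 'b set)"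
      by (rule basis_exists)
    with b that[of T] show thesis
      by (simp add: has_dimension_def top_le)
  qed
  \<comment> \<open>\<open>card T = n\<close> does not give this when \<open>n = 0\<close>, since
    infinite sets have \<open>card\<close> 0.\<close>
  have fT: "finite T"
  proof -
    obtain C :: "'b set" where C: "finite C" "span C = UNIV"
      using b unfolding has_dimension_def by blast
    have "T \<subseteq> span C" using C(2) by simp
    then show ?thesis
      using independent_span_bound[OF C(1) T(1)] by blast
  qed
  have inj: "inj_on f A" for A
    using assms(4) by (rule inj_on_subset) simp
  have ind: "independent (f ` S)"
    using linear_independent_injective_image[OF assms(3) S(1)] inj by blast
  have spT: "A \<subseteq> span T" for A
    using T(2) by simp
  have fin: "finite (f ` S)"
    using independent_span_bound[OF fT ind spT] by (rule conjunct1)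
  have card: "card (f ` S) = n"
    unfolding card_image[OF inj] by (rule S(3))
  have "y \<in> span (f ` S)" for y
  proof (rule ccontr)
    assume y: "y \<notin> span (f ` S)"
    have "y \<notin> f ` S"
      using y by (rule contrapos_nn) (rule span_base)
    have "card (insert y (f ` S)) = Suc n"
      unfolding card_insert_disjoint[OF fin \<open>y \<notin> f ` S\<close>] card ..
    moreover have "card (insert y (f ` S)) \<le> n"
      using independent_span_bound[OF fT independent_insertI[OF y ind] spT] T(3)
      by (elim conjE) (simp only:)
    ultimately show False by simp
  qed
  then have "span (f ` S) = UNIV"
    by (rule UNIV_eq_I[symmetric])
  then show ?thesis
    using linear_span_image[OF assms(3), of S] S(2) by simp
qed

theorem proposition2p9:
  fixes M :: "'z::real_inner \<Rightarrow> 'y::real_inner"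
    and K :: "'z set"
    and m n :: nat
  assumes "has_dimension TYPE('z) m"
    and "has_dimension TYPE('y) n"
    and "linear M"
    and "inj M"
    and "closed K" and "convex K" and "cone K"
  shows "bij (adjoint M \<circ> M)
    \<and> dual_cone (M ` K) =
        (M \<circ> inv (adjoint M \<circ> M)) ` dual_cone K + Ker (adjoint M)
    \<and> (n = m \<longrightarrow>
        bij (adjoint M) \<and> dual_cone (M ` K) = inv (adjoint M) ` dual_cone K)"
proof -
  let ?A = "adjoint M \<circ> M"
  obtain B :: "'z set" where B: "finite B" "span B = UNIV"
    using assms(1) unfolding has_dimension_def by blast
  have adj: "M x \<bullet> y = x \<bullet> adjoint M y" for x y
    by (rule adjoint_inner[OF B assms(3)])
  \<comment> \<open>Vectors with equal inner products against every vector coincide, so linearity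
    can be tested after moving \<open>adjoint M\<close> across the product.\<close>
  have lin: "linear (adjoint M)"
  proof (rule linearI)
    show "adjoint M (x + y) = adjoint M x + adjoint M y" for x y
      by (rule vector_eq_ldot[THEN iffD1])
        (simp add: adj[symmetric] inner_add_right)
    show "adjoint M (r *\<^sub>R x) = r *\<^sub>R adjoint M x" for r x
      by (rule vector_eq_ldot[THEN iffD1])
        (simp add: adj[symmetric])
  qed
  have linA: "linear ?A"
    by (rule linear_compose[OF assms(3) lin])
  \<comment> \<open>The product of \<open>x\<close> with \<open>?A x\<close> is the squared norm of
    \<open>M x\<close>, so \<open>?A\<close> has the same trivial kernel as
    \<open>M\<close>.\<close>
  have "x = 0" if "?A x = 0" for x
  proof -
    have "M x \<bullet> M x = 0"
      using adj[of x "M x"] that by simp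
    then show ?thesis
      using assms(3,4) by (simp add: linear_injective_0)
  qed
  then have injA: "inj ?A"
    by (simp add: linear_injective_0[OF linA])
  then have bijA: "bij ?A"
    using linear_inj_imp_surj_same_dimension[OF assms(1,1) linA] by (simp add: bij_def)
  have right_inv: "adjoint M (M (inv ?A z)) = z" for z
    using surj_f_inv_f[OF bij_is_surj[OF bijA], of z] by simp
  have dual: "y \<in> dual_cone (M ` K) \<longleftrightarrow> adjoint M y \<in> dual_cone K" for y
    using adj by (simp add: dual_cone_def inner_commute)
  have "dual_cone (M ` K) = (M \<circ> inv ?A) ` dual_cone K + Ker (adjoint M)"
  proof (intro set_eqI iffI)
    fix y assume y: "y \<in> dual_cone (M ` K)"
    \<comment> \<open>This is the orthogonal projection of \<open>y\<close> onto the range of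
      \<open>M\<close>; the remainder is killed by \<open>adjoint M\<close>.\<close>
    define u where "u = M (inv ?A (adjoint M y))"
    have "u \<in> (M \<circ> inv ?A) ` dual_cone K"
      using y dual by (auto simp: u_def)
    moreover have "y - u \<in> Ker (adjoint M)"
      by (simp add: Ker_def u_def linear_diff[OF lin] right_inv)
    ultimately have "u + (y - u) \<in> (M \<circ> inv ?A) ` dual_cone K + Ker (adjoint M)"
      by (rule set_plus_intro)
    then show "y \<in> (M \<circ> inv ?A) ` dual_cone K + Ker (adjoint M)"
      by simp
  next
    fix y assume "y \<in> (M \<circ> inv ?A) ` dual_cone K + Ker (adjoint M)"
    then obtain z k where "z \<in> dual_cone K" "adjoint M k = 0" "y = M (inv ?A z) + k"
      by (auto simp: Ker_def elim!: set_plus_elim)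
    then show "y \<in> dual_cone (M ` K)"
      by (simp add: dual linear_add[OF lin] right_inv del: o_apply)
  qed
  moreover have "bij (adjoint M) \<and> dual_cone (M ` K) = inv (adjoint M) ` dual_cone K" if "n = m"
  proof -
    have bijM: "bij M"
      using linear_inj_imp_surj_same_dimension[of n M] assms that by (simp add: bij_def)
    \<comment> \<open>Writing \<open>adjoint M\<close> as a composition of two bijections makes it
      bijective, so the preimage under it becomes an image under its inverse.\<close>
    have "adjoint M = ?A \<circ> inv M"
      using bijM by (simp add: fun_eq_iff bij_is_surj surj_f_inv_f)
    then have bijadj: "bij (adjoint M)"
      using bij_comp[OF bij_imp_bij_inv[OF bijM] bijA] by simp
    have "dual_cone (M ` K) = adjoint M -` dual_cone K"
      using dual by blast
    then show ?thesis
      using bijadj bij_vimage_eq_inv_image by blast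
  qed
  ultimately show ?thesis
    using bijA by blast
qed

end
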